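(* Fix a slot $t$ with market price $p(t)\in[p_{\min},p_{\max}]$ and demand $d(t)>0$, output rate $\rho_d>0$, existing virtual storages $i=1,\dots,v-1$ with capacities $B_i>0$ and reservation prices $\xi_i\in[p_{\min},p_{\max}/\alpha]$, and a new virtual storage $v$ with reservation price $\xi_v=p_{\max}/\alpha$. For $B'\ge0$ let $\hat x(B')=\sum_{i=1}^{v-1}[G_{B_i}(p(t))-G_{B_i}(\xi_i)]^++[G_{B'}(p(t))-G_{B'}(\xi_v)]^+$. The procedure InitVS, which starts from $B^{(0)}=d(t)$ and iterates $B^{(k+1)}=d(t)-[d(t)-\rho_d-\hat x(B^{(k)})]^+$ (stopping when two successive iterates differ by at most $\varepsilon_1>0$), converges to a value $B_v$ such that $B_v$ and $\hat x(t)=\hat x(B_v)$ satisfy simultaneously $$\hat x(t)=\sum_{i=1}^{v}[G_{B_i}(p(t))-G_{B_i}(\xi_i)]^+\quad\text{and}\quad B_v=d(t)-[d(t)-\rho_d-\hat x(t)]^+ .$$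
   Context: $0<p_{\min}<p_{\max}$, $\theta=p_{\max}/p_{\min}$, $\alpha=\left(W\!\left(-\frac{\theta-1}{\theta e}\right)+1\right)^{-1}$ with $W$ the principal branch of the Lambert-$W$ function. For $B'\ge0$, $G_{B'}(p)=\alpha B'\ln\left[\left(1-\frac{p}{p_{\max}}\right)\frac{\alpha}{\alpha-1}\right]$ for $p\in[p_{\min},p_{\max}/\alpha]$ and $G_{B'}(p)=0$ for $p\ge p_{\max}/\alpha$; $[y]^+=\max\{y,0\}$. *)

theory Defs
  imports Complex_Main
begin

text \<open>
  Principal real branch: on \<open>[-1/e, \<infinity>)\<close> the unique solution \<open>w \<ge> -1\<close> of \<open>w e\<^sup>w = x\<close>.
  It is only used at arguments in \<open>(-1/e, 0)\<close>; below \<open>-1/e\<close> the value is unspecified.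
\<close>
definition Lambert_W :: "real \<Rightarrow> real" where
  "Lambert_W x = (THE w. w \<ge> -1 \<and> w * exp w = x)"

definition alpha :: "real \<Rightarrow> real \<Rightarrow> real" where
  "alpha pmin pmax =
     (let \<theta> = pmax / pmin
      in inverse (Lambert_W (- ((\<theta> - 1) / (\<theta> * exp 1))) + 1))"

definition pos_part :: "real \<Rightarrow> real" where
  "pos_part y = max y 0"

text \<open>
  The value is only meaningful for prices \<open>p \<ge> pmin\<close>; both branches agree (with value 0)
  at \<open>p = pmax / \<alpha>\<close>.
\<close>
definition G :: "real \<Rightarrow> real \<Rightarrow> real \<Rightarrow> real \<Rightarrow> real" where
  "G pmin pmax B' p =
     (let \<alpha> = alpha pmin pmax
      in if p \<le> pmax / \<alpha>
         then \<alpha> * B' * ln ((1 - p / pmax) * (\<alpha> / (\<alpha> - 1)))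
         else 0)"

text \<open>
  Here \<open>B i\<close> and \<open>\<xi> i\<close> are the capacity and reservation price of storage \<open>i\<close>, and \<open>p\<close> is the
  current price. The entry \<open>B v\<close> is not used: the capacity of the new storage \<open>v\<close> is the
  last argument.
\<close>
definition xhat ::
  "real \<Rightarrow> real \<Rightarrow> nat \<Rightarrow> (nat \<Rightarrow> real) \<Rightarrow> (nat \<Rightarrow> real) \<Rightarrow> real \<Rightarrow> real \<Rightarrow> real" where
  "xhat pmin pmax v B \<xi> p B' =
     (\<Sum>i\<in>{1..<v}. pos_part (G pmin pmax (B i) p - G pmin pmax (B i) (\<xi> i)))
     + pos_part (G pmin pmax B' p - G pmin pmax B' (\<xi> v))"

text \<open>
  The \<open>k\<close>-th iterate of the procedure at price \<open>p\<close>, demand \<open>d\<close> and output rate \<open>\<rho>\<close>, without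
  regard to the stopping rule.
\<close>
primrec InitVS_iter ::
  "real \<Rightarrow> real \<Rightarrow> nat \<Rightarrow> (nat \<Rightarrow> real) \<Rightarrow> (nat \<Rightarrow> real) \<Rightarrow> real \<Rightarrow> real \<Rightarrow> real \<Rightarrow> nat \<Rightarrow> real" where
  "InitVS_iter pmin pmax v B \<xi> p d \<rho> 0 = d"
| "InitVS_iter pmin pmax v B \<xi> p d \<rho> (Suc k) =
     d - pos_part (d - \<rho> - xhat pmin pmax v B \<xi> p (InitVS_iter pmin pmax v B \<xi> p d \<rho> k))"

definition InitVS_stops_at ::
  "real \<Rightarrow> real \<Rightarrow> nat \<Rightarrow> (nat \<Rightarrow> real) \<Rightarrow> (nat \<Rightarrow> real) \<Rightarrow> real \<Rightarrow> real \<Rightarrow> real \<Rightarrow> real \<Rightarrow> nat \<Rightarrow> bool" where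
  "InitVS_stops_at pmin pmax v B \<xi> p d \<rho> \<epsilon> k \<longleftrightarrow>
     \<bar>InitVS_iter pmin pmax v B \<xi> p d \<rho> (Suc k) - InitVS_iter pmin pmax v B \<xi> p d \<rho> k\<bar> \<le> \<epsilon>"

end

theory Submission
  imports Defs
begin

text \<open>
  At the reservation price \<open>\<xi> v = pmax / \<alpha>\<close> the function \<open>G\<close> vanishes, and \<open>G\<close> is linear in the
  capacity. Hence, on nonnegative capacities, \<open>xhat\<close> has the form \<open>B' \<mapsto> C + K B'\<close> with
  \<open>C, K \<ge> 0\<close>, and one step of the procedure is the continuous nondecreasing map
  \<open>B' \<mapsto> min d (\<rho> + C + K B')\<close>, which sends \<open>d\<close> to a value at most \<open>d\<close>. The iterates therefore
  decrease from \<open>d\<close>, stay nonnegative, and converge to a fixed point.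
\<close>

lemma pos_part_nonneg: "0 \<le> pos_part y"
  by (simp add: pos_part_def)

lemma pos_part_mult_nonneg:
  assumes "0 \<le> a"
  shows "pos_part (a * y) = a * pos_part y"
  using assms by (simp add: pos_part_def max_mult_distrib_left)

lemma diff_pos_part_diff: "d - pos_part (d - y) = min d y"
  by (simp add: pos_part_def)

lemma G_linear_capacity: "G pmin pmax B' p = B' * G pmin pmax 1 p"
  by (simp add: G_def Let_def)

text \<open>
  This holds for every value of \<open>\<alpha>\<close>: in the degenerate cases \<open>\<alpha> = 0\<close> and \<open>\<alpha> = 1\<close> it is a
  consequence of \<open>x / 0 = 0\<close> and \<open>ln 0 = 0\<close>.
\<close>
lemma G_reservation_price:
  assumes "pmax \<noteq> 0"
  shows "G pmin pmax B' (pmax / alpha pmin pmax) = 0"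
proof -
  define a where "a = alpha pmin pmax"
  have "a * ln ((1 - pmax / a / pmax) * (a / (a - 1))) = 0"
  proof (cases "a = 0 \<or> a = 1")
    case True
    then show ?thesis by auto
  next
    case False
    with assms have "(1 - pmax / a / pmax) * (a / (a - 1)) = 1"
      by (simp add: field_simps)
    then show ?thesis by simp
  qed
  then show ?thesis
    by (auto simp: G_def Let_def a_def)
qed

lemma xhat_affine:
  assumes "pmax \<noteq> 0" and "\<xi> v = pmax / alpha pmin pmax" and "0 \<le> B'"
  shows "xhat pmin pmax v B \<xi> p B' =
    (\<Sum>i\<in>{1..<v}. pos_part (G pmin pmax (B i) p - G pmin pmax (B i) (\<xi> i)))
    + pos_part (G pmin pmax 1 p) * B'"
proof -
  \<comment> \<open>Pulling \<open>B'\<close> out of the positive part uses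
    \<open>0 \<le> B'\<close>; hence the affine form is claimed only for such capacities.\<close>
  have "pos_part (G pmin pmax B' p - G pmin pmax B' (\<xi> v)) = B' * pos_part (G pmin pmax 1 p)"
    unfolding assms(2) G_reservation_price[OF assms(1)] diff_zero
    by (subst G_linear_capacity) (rule pos_part_mult_nonneg[OF assms(3)])
  then show ?thesis
    by (simp add: xhat_def mult.commute)
qed

text \<open>Overwriting \<open>B\<close> at \<open>v\<close> affects only the last summand, so the
  separately added term of the new storage joins one sum over all \<open>v\<close> storages.\<close>

lemma xhat_fun_upd:
  assumes "1 \<le> v"
  shows "xhat pmin pmax v B \<xi> p B' =
    (\<Sum>i\<in>{1..v}. pos_part (G pmin pmax ((B(v := B')) i) p - G pmin pmax ((B(v := B')) i) (\<xi> i)))"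
proof -
  have "{1..v} = insert v {1..<v}"
    using assms by auto
  then show ?thesis
    by (simp add: xhat_def add.commute)
qed

text \<open>Monotonicity passes the first descent on to all later steps, and continuity makes the
  limit a fixed point. Both are asked only on \<open>{a..}\<close>, because the step map has its
  closed form only for nonnegative arguments.\<close>

lemma decreasing_iterates_converge:
  fixes f :: "real \<Rightarrow> real" and x :: "nat \<Rightarrow> real"
  assumes step: "\<And>k. x (Suc k) = f (x k)"
    and first: "f (x 0) \<le> x 0" and start: "a \<le> x 0"
    and bound: "\<And>y. a \<le> y \<Longrightarrow> a \<le> f y"
    and mono: "\<And>y z. a \<le> y \<Longrightarrow> y \<le> z \<Longrightarrow> f y \<le> f z"
    and cont: "continuous_on {a..} f"
  obtains l where "a \<le> l" "x \<longlonglongrightarrow> l" "f l = l"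
proof -
  have lower: "a \<le> x k" for k
    by (induction k) (simp_all add: start step bound)
  have "x (Suc k) \<le> x k" for k
  proof (induction k)
    case 0
    show ?case using first by (simp add: step)
  next
    case (Suc k)
    from mono[OF lower Suc] show ?case by (simp only: step)
  qed
  then have "decseq x"
    by (rule decseq_SucI)
  then obtain l where lim: "x \<longlonglongrightarrow> l"
    using decseq_convergent lower by blast
  have "a \<le> l"
    using lim lower by (intro LIMSEQ_le_const) auto
  then have "(\<lambda>k. f (x k)) \<longlonglongrightarrow> f l"
    using lower by (intro continuous_on_tendsto_compose[OF cont lim]) auto
  moreover have "(\<lambda>k. f (x k)) \<longlonglongrightarrow> l"
    using LIMSEQ_Suc[OF lim] by (simp add: step)
  ultimately have "f l = l"
    by (rule LIMSEQ_unique)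
  with \<open>a \<le> l\<close> lim show thesis by (rule that)
qed

text \<open>Used for the stopping rule: the sequence and its shift have the same limit, so their
  difference tends to 0.\<close>

lemma convergent_imp_consecutive_close:
  fixes x :: "nat \<Rightarrow> real"
  assumes "x \<longlonglongrightarrow> l" and "0 < e"
  shows "\<exists>k. \<bar>x (Suc k) - x k\<bar> \<le> e"
proof -
  have "(\<lambda>k. x (Suc k) - x k) \<longlonglongrightarrow> 0"
    using tendsto_diff[OF LIMSEQ_Suc[OF assms(1)] assms(1)] by simp
  from LIMSEQ_D[OF this assms(2)] show ?thesis
    by (auto intro: less_imp_le)
qed

theorem theoremC1:
  fixes pmin pmax \<rho>d \<epsilon>1 :: real
    and p d :: "nat \<Rightarrow> real"
    and t v :: nat
    and B \<xi> :: "nat \<Rightarrow> real"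
  assumes "0 < pmin" and "pmin < pmax"
    and "pmin \<le> p t" and "p t \<le> pmax"
    and "0 < d t"
    and "0 < \<rho>d"
    and "0 < \<epsilon>1"
    and "1 \<le> v"
    and "\<And>i. 1 \<le> i \<Longrightarrow> i < v \<Longrightarrow> 0 < B i"
    and "\<And>i. 1 \<le> i \<Longrightarrow> i < v \<Longrightarrow> pmin \<le> \<xi> i \<and> \<xi> i \<le> pmax / alpha pmin pmax"
    and "\<xi> v = pmax / alpha pmin pmax"
  shows "(\<exists>k. InitVS_stops_at pmin pmax v B \<xi> (p t) (d t) \<rho>d \<epsilon>1 k) \<and>
    (\<exists>Bv xh. 0 \<le> Bv \<and>
      (\<lambda>k. InitVS_iter pmin pmax v B \<xi> (p t) (d t) \<rho>d k) \<longlonglongrightarrow> Bv \<and>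
      xh = xhat pmin pmax v B \<xi> (p t) Bv \<and>
      xh = (\<Sum>i\<in>{1..v}. pos_part (G pmin pmax ((B(v := Bv)) i) (p t)
                                   - G pmin pmax ((B(v := Bv)) i) (\<xi> i))) \<and>
      Bv = d t - pos_part (d t - \<rho>d - xh))"
proof -
  define C where
    "C = (\<Sum>i\<in>{1..<v}. pos_part (G pmin pmax (B i) (p t) - G pmin pmax (B i) (\<xi> i)))"
  define K where "K = pos_part (G pmin pmax 1 (p t))"
  define x where "x = InitVS_iter pmin pmax v B \<xi> (p t) (d t) \<rho>d"
  define f where
    "f = (\<lambda>b. d t - pos_part (d t - \<rho>d - xhat pmin pmax v B \<xi> (p t) b))"
  have C: "0 \<le> C" and K: "0 \<le> K"
    by (auto simp: C_def K_def pos_part_nonneg intro!: sum_nonneg)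
  have f: "f b = min (d t) (\<rho>d + C + K * b)" if "0 \<le> b" for b
  proof -
    have "xhat pmin pmax v B \<xi> (p t) b = C + K * b"
      unfolding C_def K_def using assms(1,2,11) that by (intro xhat_affine) auto
    then show ?thesis
      using diff_pos_part_diff[of "d t" "\<rho>d + C + K * b"] by (simp add: f_def algebra_simps)
  qed
  obtain Bv where Bv: "0 \<le> Bv" and lim: "x \<longlonglongrightarrow> Bv" and fix_Bv: "f Bv = Bv"
  proof (rule decreasing_iterates_converge[of x f 0])
    show "x (Suc k) = f (x k)" for k
      by (simp add: x_def f_def)
    \<comment> \<open>The start \<open>x 0\<close> is \<open>d t\<close>, an upper bound for every
      value of \<open>f\<close>.\<close>
    show "f (x 0) \<le> x 0"
      by (simp add: x_def f_def pos_part_nonneg)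
    show "0 \<le> x 0"
      using assms(5) by (simp add: x_def)
    \<comment> \<open>Both arguments of the minimum, \<open>d t\<close> and
      \<open>\<rho>d + C + K * y\<close>, are nonnegative.\<close>
    show "0 \<le> f y" if "0 \<le> y" for y
      using that assms(5,6) C K by (simp add: f)
    show "f y \<le> f z" if "0 \<le> y" "y \<le> z" for y z
    proof -
      have "K * y \<le> K * z"
        using that K by (intro mult_left_mono)
      then show ?thesis
        using that by (simp add: f min_le_iff_disj)
    qed
    have "continuous_on {0..} f \<longleftrightarrow> continuous_on {0..} (\<lambda>b. min (d t) (\<rho>d + C + K * b))"
      by (rule continuous_on_cong) (simp_all add: f)
    also have "\<dots>"
      by (intro continuous_intros)
    finally show "continuous_on {0..} f" .
  qed
  have "\<exists>k. InitVS_stops_at pmin pmax v B \<xi> (p t) (d t) \<rho>d \<epsilon>1 k"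
    using convergent_imp_consecutive_close[OF lim assms(7)]
    by (simp only: InitVS_stops_at_def x_def)
  moreover have "Bv = d t - pos_part (d t - \<rho>d - xhat pmin pmax v B \<xi> (p t) Bv)"
    using fix_Bv by (simp add: f_def)
  ultimately show ?thesis
    using Bv lim[unfolded x_def]
    by (intro conjI exI[of _ Bv] exI[of _ "xhat pmin pmax v B \<xi> (p t) Bv"]
        xhat_fun_upd[OF assms(8)] refl)
qed

end
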